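(* (a) If Crouzeix's conjecture holds for all $n\times n$ matrices, then Crouzeix's conjecture holds for all $(n+1)\times(n+1)$ non-cyclic matrices. (b) If Crouzeix's conjecture holds for all cyclic matrices, then Crouzeix's conjecture holds in full generality (i.e. for all square complex matrices).
   Context: All matrices are square with complex entries. $W(A)=\{\langle Ax,x\rangle:\langle x,x\rangle=1\}$ is the numerical range with respect to the Euclidean inner product, and $\|\cdot\|$ is the operator norm induced by the Euclidean norm. Crouzeix's conjecture holds for a matrix $A$ if $\|p(A)\|\le 2\sup_{z\in W(A)}|p(z)|$ for every complex polynomial $p$. A vector $y\in\mathbb{C}^n$ is cyclic for an $n\times n$ matrix $A$ if $\operatorname{span}\{y,Ay,A^2y,\ldots\}=\mathbb{C}^n$; $A$ is cyclic if there is a vector $y\in\mathbb{C}^n$ cyclic for $A$, and non-cyclic otherwise. *)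

theory Defs
  imports
    Jordan_Normal_Form.VS_Connect
    "HOL-Computational_Algebra.Polynomial"
begin

text \<open>
  The scalar product \<^term>\<open>x \<bullet>c y\<close> is conjugate-linear in its second argument, so
  \<open>(A *\<^sub>v x) \<bullet>c x\<close> is the Euclidean \<open>\<langle>A x, x\<rangle>\<close>.
  The real suprema below range over nonempty bounded sets as soon as the matrix is
  square of size at least 1; for the \<open>0 \<times> 0\<close> matrix the numerical range is empty
  and the supremum over it is unspecified.
\<close>

definition numerical_range :: "complex mat \<Rightarrow> complex set" where
  "numerical_range A = {(A *\<^sub>v x) \<bullet>c x | x. x \<in> carrier_vec (dim_col A) \<and> x \<bullet>c x = 1}"

definition euclidean_norm :: "complex vec \<Rightarrow> real" where
  "euclidean_norm x = sqrt (Re (x \<bullet>c x))"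

definition operator_norm :: "complex mat \<Rightarrow> real" where
  "operator_norm A =
     (SUP x \<in> {x \<in> carrier_vec (dim_col A). euclidean_norm x \<le> 1}. euclidean_norm (A *\<^sub>v x))"

text \<open>
  \<open>p(A) = \<Sum>\<^sub>k coeff p k \<cdot> A\<^sup>k\<close>, written entrywise because
  \<^typ>\<open>complex mat\<close> carries no additive monoid structure on the whole type.
\<close>

definition mat_poly :: "complex poly \<Rightarrow> complex mat \<Rightarrow> complex mat" where
  "mat_poly p A =
     mat (dim_row A) (dim_row A) (\<lambda>(i, j). \<Sum>k\<le>degree p. coeff p k * (A ^\<^sub>m k) $$ (i, j))"

definition crouzeix_holds :: "complex mat \<Rightarrow> bool" where
  "crouzeix_holds A \<longleftrightarrow>
     (\<forall>p :: complex poly.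
        operator_norm (mat_poly p A) \<le> 2 * (SUP z \<in> numerical_range A. cmod (poly p z)))"

definition cyclic_vector :: "complex mat \<Rightarrow> complex vec \<Rightarrow> bool" where
  "cyclic_vector A y \<longleftrightarrow>
     y \<in> carrier_vec (dim_row A) \<and>
     LinearCombinations.module.span class_ring (module_vec TYPE(complex) (dim_row A))
       (range (\<lambda>k :: nat. (A ^\<^sub>m k) *\<^sub>v y)) = carrier_vec (dim_row A)"

definition cyclic_mat :: "complex mat \<Rightarrow> bool" where
  "cyclic_mat A \<longleftrightarrow> (\<exists>y. cyclic_vector A y)"

end

theory Submission
  imports Defs "HOL-Computational_Algebra.Fundamental_Theorem_Algebra"
begin

text \<open>
  If \<open>x\<close> is not a cyclic vector of \<open>A\<close>, then its Krylov space is orthogonal to some \<open>w \<noteq> 0\<close>, and the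
  \<open>A\<^sup>*\<close>-invariant space generated by \<open>w\<close> contains an eigenvector of \<open>A\<^sup>*\<close>; its orthogonal complement
  is an \<open>A\<close>-invariant hyperplane through \<open>x\<close>. The restriction \<open>C\<close> of \<open>A\<close> to this hyperplane satisfies
  \<open>W(C) \<subseteq> W(A)\<close> and \<open>\<parallel>p(A) x\<parallel> \<le> \<parallel>p(C)\<parallel> \<parallel>x\<parallel>\<close>. If \<open>A\<close> is not cyclic this applies to every \<open>x\<close>, so the
  bound for all \<open>C\<close> one dimension lower gives the bound for \<open>A\<close>. Part (b) is induction on the size,
  starting from the fact that \<open>1 \<times> 1\<close> matrices are cyclic.
\<close>

section \<open>Products and powers of matrices acting on vectors\<close>

lemma mult_mat_vec_index:
  "i < dim_row M \<Longrightarrow> dim_col M = dim_vec x \<Longrightarrow> (M *\<^sub>v x) $ i = (\<Sum>j<dim_vec x. M $$ (i, j) * x $ j)"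
  by (simp add: scalar_prod_def atLeast0LessThan)

lemma pow_mat_Suc_left:
  assumes "A \<in> carrier_mat n n"
  shows "A ^\<^sub>m Suc k = A * A ^\<^sub>m k"
proof (induction k)
  case 0
  then show ?case using assms by simp
next
  case (Suc k)
  have "A ^\<^sub>m Suc (Suc k) = A * A ^\<^sub>m k * A" using Suc by simp
  also have "\<dots> = A * A ^\<^sub>m Suc k"
    using assms by (simp add: assoc_mult_mat[OF assms pow_carrier_mat[OF assms] assms])
  finally show ?case .
qed

lemma pow_mat_Suc_mult_vec:
  assumes "A \<in> carrier_mat n n" "x \<in> carrier_vec n"
  shows "A ^\<^sub>m Suc k *\<^sub>v x = A *\<^sub>v (A ^\<^sub>m k *\<^sub>v x)"
  using assms by (simp only: pow_mat_Suc_left assoc_mult_mat_vec[OF assms(1) pow_carrier_mat])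

lemma pow_mat_mult_vec_carrier [simp]:
  assumes "A \<in> carrier_mat n n" "x \<in> carrier_vec n"
  shows "A ^\<^sub>m k *\<^sub>v x \<in> carrier_vec n"
  using mult_mat_vec_carrier[OF pow_carrier_mat[OF assms(1)] assms(2)] .

lemma transpose_pow_mat:
  fixes A :: "'a :: comm_semiring_1 mat"
  assumes "A \<in> carrier_mat n n"
  shows "A\<^sup>T ^\<^sub>m k = (A ^\<^sub>m k)\<^sup>T"
proof (induction k)
  case 0
  then show ?case using assms by simp
next
  case (Suc k)
  have "A\<^sup>T ^\<^sub>m Suc k = (A ^\<^sub>m k)\<^sup>T * A\<^sup>T" using Suc by simp
  also have "\<dots> = (A * A ^\<^sub>m k)\<^sup>T"
    using assms by (simp add: transpose_mult[OF assms pow_carrier_mat[OF assms]])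
  also have "\<dots> = (A ^\<^sub>m Suc k)\<^sup>T" by (simp only: pow_mat_Suc_left[OF assms])
  finally show ?case .
qed

section \<open>From a non-cyclic vector to an eigenvector of the transpose\<close>

text \<open>Put the first n Krylov vectors into the columns of a square matrix \<open>K\<close>.
  Were \<open>K\<close> invertible, they would already span the whole space and \<open>x\<close>
  would be cyclic; so \<open>K\<close> is singular, and a kernel vector of its transpose is the
  required \<open>w\<close>.\<close>

lemma not_cyclic_vector_left_kernel:
  fixes A :: "complex mat"
  assumes A: "A \<in> carrier_mat n n" and x: "x \<in> carrier_vec n" and nc: "\<not> cyclic_vector A x"
  obtains w where "w \<in> carrier_vec n" "w \<noteq> 0\<^sub>v n" "\<And>k. k < n \<Longrightarrow> w \<bullet> (A ^\<^sub>m k *\<^sub>v x) = 0"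
proof -
  interpret vec_space "TYPE(complex)" n .
  define ws where "ws = map (\<lambda>k. A ^\<^sub>m k *\<^sub>v x) [0..<n]"
  define K where "K = mat_of_cols n ws"
  have ws: "set ws \<subseteq> carrier_vec n" "length ws = n"
    using A x by (auto simp: ws_def)
  have K: "K \<in> carrier_mat n n" using mat_of_cols_carrier(1)[of n ws] ws(2) by (simp add: K_def)
  have "det K = 0"
  proof (rule ccontr)
    assume "det K \<noteq> 0"
    from det_non_zero_imp_unit[OF K this, unfolded Units_def, of "()"]
    obtain B where B: "B \<in> carrier_mat n n" "K * B = 1\<^sub>m n" by (auto simp: ring_mat_def)
    have "y \<in> span (set ws)" if y: "y \<in> carrier_vec n" for y
    proof -
      \<comment> \<open>The entries of \<open>B *\<^sub>v y\<close> are the coefficients of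
        \<open>y\<close> as a combination of the Krylov vectors.\<close>
      have "y = K *\<^sub>v (B *\<^sub>v y)" using K B y by (simp flip: assoc_mult_mat_vec)
      also have "\<dots> = K *\<^sub>v vec (length ws) (($) (B *\<^sub>v y))"
        using ws B y by (intro arg_cong[where f = "(*\<^sub>v) K"]) auto
      also have "\<dots> = lincomb_list (($) (B *\<^sub>v y)) ws"
        unfolding K_def using ws by (intro lincomb_list_as_mat_mult[symmetric]) auto
      also have "\<dots> \<in> span_list ws" by (auto simp: span_list_def)
      finally show ?thesis using span_list_as_span[OF ws(1)] by simp
    qed
    moreover have "span (set ws) \<subseteq> span (range (\<lambda>k. A ^\<^sub>m k *\<^sub>v x))"
      by (rule span_is_monotone) (auto simp: ws_def)
    moreover have "span (range (\<lambda>k. A ^\<^sub>m k *\<^sub>v x)) \<subseteq> carrier_vec n"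
    proof -
      have "range (\<lambda>k. A ^\<^sub>m k *\<^sub>v x) \<subseteq> carrier_vec n" using A x by auto
      thus ?thesis using span_closed by blast
    qed
    ultimately have "span (range (\<lambda>k. A ^\<^sub>m k *\<^sub>v x)) = carrier_vec n" by blast
    with nc show False using A x by (simp add: cyclic_vector_def)
  qed
  hence "det K\<^sup>T = 0" using det_transpose[OF K] by simp
  then obtain w where w: "w \<in> carrier_vec n" "w \<noteq> 0\<^sub>v n" "K\<^sup>T *\<^sub>v w = 0\<^sub>v n"
    using det_0_iff_vec_prod_zero_field[of "K\<^sup>T" n] K by auto
  have "w \<bullet> (A ^\<^sub>m k *\<^sub>v x) = 0" if "k < n" for k
  proof -
    have "(A ^\<^sub>m k *\<^sub>v x) \<bullet> w = (K\<^sup>T *\<^sub>v w) $ k"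
      using that K ws A x by (simp add: K_def ws_def col_mat_of_cols)
    moreover have "A ^\<^sub>m k *\<^sub>v x \<in> carrier_vec n" using A x by auto
    ultimately show ?thesis using w that comm_scalar_prod[OF w(1)] by simp
  qed
  with w that show ?thesis by blast
qed

text \<open>The n + 1 vectors \<open>v 0\<close>, ..., \<open>v n\<close> live in dimension n, so
  they are linearly dependent; the coefficients of a dependence become those of
  \<open>q\<close>.\<close>

lemma annihilating_poly_exists:
  fixes v :: "nat \<Rightarrow> 'a :: field vec"
  assumes v: "\<And>k. v k \<in> carrier_vec n"
  obtains q :: "'a poly" where "q \<noteq> 0" "degree q \<le> n" "\<And>i. i < n \<Longrightarrow> (\<Sum>k\<le>n. coeff q k * v k $ i) = 0"
proof -
  \<comment> \<open>The vectors are the columns, padded by a zero last row to make \<open>M\<close>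
    square. That row puts the last unit vector into the kernel of the transpose, so \<open>M\<close>
    is singular.\<close>
  define M where "M = mat (Suc n) (Suc n) (\<lambda>(i, k). if i < n then v k $ i else 0)"
  have M: "M \<in> carrier_mat (Suc n) (Suc n)" by (simp add: M_def)
  have "M\<^sup>T *\<^sub>v unit_vec (Suc n) n = 0\<^sub>v (Suc n)"
    by (rule eq_vecI) (auto simp: M_def)
  moreover have "unit_vec (Suc n) n \<noteq> (0\<^sub>v (Suc n) :: 'a vec)" by simp
  ultimately have "det M\<^sup>T = 0"
    using det_0_iff_vec_prod_zero_field[of "M\<^sup>T" "Suc n"] M unit_vec_carrier by (metis transpose_carrier_mat)
  hence "det M = 0" using det_transpose[OF M] by simp
  then obtain c where c: "c \<in> carrier_vec (Suc n)" "c \<noteq> 0\<^sub>v (Suc n)" "M *\<^sub>v c = 0\<^sub>v (Suc n)"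
    using det_0_iff_vec_prod_zero_field[OF M] by auto
  define q where "q = Poly (list_of_vec c)"
  have cq: "coeff q k = c $ k" if "k \<le> n" for k
    using that c by (simp add: q_def nth_default_def list_of_vec_index)
  have "q \<noteq> 0"
  proof
    assume "q = 0"
    hence "c $ k = 0" if "k < Suc n" for k using cq[of k] that by simp
    hence "c = 0\<^sub>v (Suc n)" using c by (intro eq_vecI) auto
    with c show False by simp
  qed
  moreover have "degree q \<le> n"
    by (rule degree_le) (use c in \<open>auto simp: q_def nth_default_def\<close>)
  moreover have "(\<Sum>k\<le>n. coeff q k * v k $ i) = 0" if "i < n" for i
  proof -
    have "(\<Sum>k\<le>n. coeff q k * v k $ i) = (M *\<^sub>v c) $ i"
      using that c by (subst mult_mat_vec_index)
        (auto simp: M_def cq lessThan_Suc_atMost mult.commute intro!: sum.cong)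
    thus ?thesis using c that by simp
  qed
  ultimately show ?thesis using that by blast
qed

text \<open>Choose \<open>q\<close> of least degree annihilating \<open>w\<close> under the
  transpose of \<open>A\<close> and split off a root: q = (X - c) r. Then \<open>u\<close>, which is
  r applied to the transpose and then to \<open>w\<close>, is nonzero by minimality, and applying X
  - c gives zero. As a combination of the \<open>v k\<close> with k < n it pairs to zero with
  \<open>x\<close>. The pairing is bilinear, so it is the conjugate of \<open>u\<close> that is an
  eigenvector of the adjoint.\<close>

lemma not_cyclic_vector_left_eigenvector:
  fixes A :: "complex mat"
  assumes A: "A \<in> carrier_mat n n" and x: "x \<in> carrier_vec n" and nc: "\<not> cyclic_vector A x"
  obtains u c where "u \<in> carrier_vec n" "u \<noteq> 0\<^sub>v n" "A\<^sup>T *\<^sub>v u = c \<cdot>\<^sub>v u" "x \<bullet> u = 0"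
proof -
  obtain w where w: "w \<in> carrier_vec n" "w \<noteq> 0\<^sub>v n" "\<And>k. k < n \<Longrightarrow> w \<bullet> (A ^\<^sub>m k *\<^sub>v x) = 0"
    using not_cyclic_vector_left_kernel[OF assms] by blast
  define v where "v k = A\<^sup>T ^\<^sub>m k *\<^sub>v w" for k
  have AT: "A\<^sup>T \<in> carrier_mat n n" using A by simp
  have v: "v k \<in> carrier_vec n" for k using pow_carrier_mat[OF AT, of k] w(1) by (simp add: v_def)
  have v_Suc: "v (Suc k) = A\<^sup>T *\<^sub>v v k" for k
    unfolding v_def using pow_mat_Suc_mult_vec[OF AT w(1)] .
  have v_orth: "x \<bullet> v k = 0" if "k < n" for k
  proof -
    have Ak: "A ^\<^sub>m k \<in> carrier_mat n n" using A by simp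
    have "x \<bullet> v k = v k \<bullet> x" using comm_scalar_prod[OF x v] .
    also have "\<dots> = w \<bullet> (A ^\<^sub>m k *\<^sub>v x)"
      using transpose_vec_mult_scalar[OF Ak x w(1)] by (simp add: v_def transpose_pow_mat[OF A])
    finally show ?thesis using w that by simp
  qed
  define ann where "ann q \<longleftrightarrow> q \<noteq> 0 \<and> degree q \<le> n \<and> (\<forall>i<n. (\<Sum>k\<le>n. coeff q k * v k $ i) = 0)" for q
  have "\<exists>q. ann q" using annihilating_poly_exists[of v n] v unfolding ann_def by metis
  then obtain q where q: "ann q" and q_min: "\<And>r. ann r \<Longrightarrow> degree q \<le> degree r"
    using ex_has_least_nat[of ann _ degree] by blast
  have q0: "q \<noteq> 0" and degq: "degree q \<le> n"
    and sumq: "\<And>i. i < n \<Longrightarrow> (\<Sum>k\<le>n. coeff q k * v k $ i) = 0"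
    using q by (auto simp: ann_def)
  \<comment> \<open>A nonzero constant could annihilate only \<open>w\<close> = 0.\<close>
  have "degree q \<noteq> 0"
  proof
    assume "degree q = 0"
    then obtain a where a: "q = [:a:]" "a \<noteq> 0" using q0 by (metis degree_eq_zeroE pCons_0_0)
    have "w $ i = 0" if "i < n" for i
    proof -
      have "(\<Sum>k\<le>n. coeff q k * v k $ i) = a * v 0 $ i"
        by (subst sum.atMost_shift) (simp add: a)
      thus ?thesis using sumq[OF that] a w by (simp add: v_def) (use A in simp)
    qed
    hence "w = 0\<^sub>v n" using w by (intro eq_vecI) auto
    with w show False by simp
  qed
  hence "\<not> constant (poly q)" by (simp add: constant_degree)
  then obtain c where "poly q c = 0" using fundamental_theorem_of_algebra by blast
  then obtain r where r: "q = [:-c, 1:] * r" by (auto simp: poly_eq_0_iff_dvd dvd_def)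
  have r0: "r \<noteq> 0" using q0 r by auto
  have degr: "degree q = Suc (degree r)" unfolding r by (subst degree_mult_eq) (use r0 in auto)
  have coeff_q: "coeff q k = (case k of 0 \<Rightarrow> 0 | Suc m \<Rightarrow> coeff r m) - c * coeff r k" for k
    by (simp add: r coeff_pCons split: nat.split)
  define u where "u = vec n (\<lambda>i. \<Sum>k<n. coeff r k * v k $ i)"
  have u: "u \<in> carrier_vec n" by (simp add: u_def)
  \<comment> \<open>\<open>r\<close> has smaller degree than \<open>q\<close>, hence degree below n,
    so its coefficient at n vanishes.\<close>
  have u_alt: "(\<Sum>k\<le>n. coeff r k * v k $ i) = u $ i" if "i < n" for i
    using that degr degq coeff_eq_0[of r n] by (simp add: u_def flip: lessThan_Suc_atMost)
  have "u \<noteq> 0\<^sub>v n"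
  proof
    assume "u = 0\<^sub>v n"
    hence "ann r" using r0 degr degq u_alt by (simp add: ann_def)
    from q_min[OF this] degr show False by simp
  qed
  moreover have "A\<^sup>T *\<^sub>v u = c \<cdot>\<^sub>v u"
  proof (rule eq_vecI)
    fix i assume "i < dim_vec (c \<cdot>\<^sub>v u)"
    hence i: "i < n" using u by simp
    have "(A\<^sup>T *\<^sub>v u) $ i = (\<Sum>j<n. A\<^sup>T $$ (i, j) * (\<Sum>k<n. coeff r k * v k $ j))"
      using i AT by (subst mult_mat_vec_index) (auto simp: u_def intro!: sum.cong)
    also have "\<dots> = (\<Sum>k<n. coeff r k * (\<Sum>j<n. A\<^sup>T $$ (i, j) * v k $ j))"
      unfolding sum_distrib_left by (subst sum.swap) (simp add: mult_ac)
    also have "\<dots> = (\<Sum>k<n. coeff r k * v (Suc k) $ i)"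
      unfolding v_Suc using i AT carrier_vecD[OF v]
      by (intro sum.cong refl, subst mult_mat_vec_index) auto
    \<comment> \<open>Shifting the index turns the coefficients of r into those of X r, and X r = q
      + c r.\<close>
    also have "\<dots> = (\<Sum>k\<le>n. (case k of 0 \<Rightarrow> 0 | Suc m \<Rightarrow> coeff r m) * v k $ i)"
      by (subst sum.atMost_shift) simp
    also have "\<dots> = (\<Sum>k\<le>n. coeff q k * v k $ i) + c * (\<Sum>k\<le>n. coeff r k * v k $ i)"
      unfolding sum_distrib_left by (subst sum.distrib[symmetric]) (simp add: coeff_q algebra_simps)
    also have "\<dots> = c * u $ i" using sumq[OF i] u_alt[OF i] by simp
    finally show "(A\<^sup>T *\<^sub>v u) $ i = (c \<cdot>\<^sub>v u) $ i" using i u by simp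
  qed (use A u in auto)
  moreover have "x \<bullet> u = 0"
  proof -
    have "x \<bullet> u = (\<Sum>i<n. x $ i * (\<Sum>k<n. coeff r k * v k $ i))"
      by (simp add: scalar_prod_def u_def atLeast0LessThan)
    also have "\<dots> = (\<Sum>k<n. coeff r k * (\<Sum>i<n. x $ i * v k $ i))"
      unfolding sum_distrib_left by (subst sum.swap) (simp add: mult_ac)
    also have "\<dots> = (\<Sum>k<n. coeff r k * (x \<bullet> v k))"
      using carrier_vecD[OF v] by (simp add: scalar_prod_def atLeast0LessThan)
    finally show ?thesis using v_orth by simp
  qed
  ultimately show ?thesis using that u by blast
qed

section \<open>An orthonormal basis of a hyperplane\<close>

text \<open>
  The columns of \<open>U\<close> are those of the Householder reflection exchanging the last basis vector
  with the normalised conjugate of \<open>u\<close>, except for the last one.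
\<close>

lemma hyperplane_isometry:
  fixes u :: "complex vec"
  assumes u: "u \<in> carrier_vec (Suc n)" "u \<noteq> 0\<^sub>v (Suc n)"
  obtains U V where "U \<in> carrier_mat (Suc n) n" "V \<in> carrier_mat n (Suc n)"
    "\<And>y. y \<in> carrier_vec n \<Longrightarrow> V *\<^sub>v (U *\<^sub>v y) = y"
    "\<And>y. y \<in> carrier_vec n \<Longrightarrow> (U *\<^sub>v y) \<bullet> u = 0"
    "\<And>x. x \<in> carrier_vec (Suc n) \<Longrightarrow> x \<bullet> u = 0 \<Longrightarrow> U *\<^sub>v (V *\<^sub>v x) = x"
    "\<And>x y. x \<in> carrier_vec (Suc n) \<Longrightarrow> y \<in> carrier_vec n \<Longrightarrow> (U *\<^sub>v y) \<bullet>c x = y \<bullet>c (V *\<^sub>v x)"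
proof -
  define m where "m = sqrt (\<Sum>i<Suc n. (cmod (u $ i))\<^sup>2)"
  have sum_pos: "(\<Sum>i<Suc n. (cmod (u $ i))\<^sup>2) > 0"
  proof -
    obtain i where "i < Suc n" "u $ i \<noteq> 0"
      using u by (metis carrier_vecD eq_vecI index_zero_vec)
    thus ?thesis by (intro sum_pos2[of _ i]) auto
  qed
  hence m: "m > 0" by (simp only: m_def real_sqrt_gt_zero)
  have m2: "m\<^sup>2 = (\<Sum>i<Suc n. (cmod (u $ i))\<^sup>2)"
    using sum_pos by (simp only: m_def real_sqrt_pow2 less_imp_le)
  \<comment> \<open>The factor scales \<open>u\<close> to a unit vector and fixes its phase so that
    \<open>g n\<close> is real and at most 0. Then \<open>s\<close> is at least 1, and dividing by
    it is safe. If the last entry of \<open>u\<close> is 0, any phase works.\<close>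
  define a where "a = (if u $ n = 0 then 1 else - cnj (u $ n) / cmod (u $ n)) / complex_of_real m"
  define g where "g i = cnj (a * u $ i)" for i
  define \<gamma> where "\<gamma> = - complex_of_real (cmod (u $ n) / m)"
  define s where "s = 1 - \<gamma>"
  have a0: "a \<noteq> 0" using m by (auto simp: a_def)
  have norm_a: "cmod a = 1 / m" using m by (auto simp: a_def norm_divide)
  have gn: "g n = \<gamma>"
    using m complex_norm_square[of "u $ n"]
    by (auto simp: g_def a_def \<gamma>_def field_simps power2_eq_square)
  have cnj_g [simp]: "cnj \<gamma> = \<gamma>" "cnj s = s" by (simp_all add: \<gamma>_def s_def)
  have s0: "s \<noteq> 0"
  proof
    assume "s = 0"
    hence "Re s = 0" by simp
    moreover have "cmod (u $ n) / m \<ge> 0" using m by simp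
    ultimately show False by (simp add: s_def \<gamma>_def)
  qed
  have g_sq: "cnj (g i) * g i = of_real ((cmod (u $ i))\<^sup>2 / m\<^sup>2)" for i
    using complex_norm_square[of "g i"]
    by (simp add: g_def norm_mult norm_a power_mult_distrib power_divide mult.commute)
  have "(\<Sum>i<Suc n. cnj (g i) * g i) = of_real ((\<Sum>i<Suc n. (cmod (u $ i))\<^sup>2) / m\<^sup>2)"
    by (simp only: g_sq of_real_sum sum_divide_distrib)
  also have "\<dots> = 1" unfolding m2[symmetric] using m by simp
  finally have "(\<Sum>i<n. cnj (g i) * g i) = 1 - \<gamma> * \<gamma>"
    by (simp add: gn algebra_simps)
  \<comment> \<open>\<open>g\<close> is a unit vector with last entry \<gamma>, and 1 - \<gamma>^2
    factors as (1 - \<gamma>)(1 + \<gamma>).\<close>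
  hence S: "(\<Sum>i<n. cnj (g i) * g i) = s * (1 + \<gamma>)" by (simp add: s_def algebra_simps)

  \<comment> \<open>With v = g - e_n one has |v|^2 = 2s, so the reflection is I - v v^* / s. In its
    last row the factor \<gamma> - 1 = -s cancels the denominator, leaving the conjugate of
    \<open>g j\<close>. \<open>V\<close> below is the adjoint of \<open>U\<close>.\<close>
  define U where "U = mat (Suc n) n (\<lambda>(i, j). if i = n then cnj (g j)
      else (if i = j then 1 else 0) - g i * cnj (g j) / s)"
  define V where "V = mat n (Suc n) (\<lambda>(i, j). cnj (U $$ (j, i)))"
  \<comment> \<open>The inner product with \<open>g\<close> over the first n coordinates only; it is
    applied to vectors of length n and of length n + 1.\<close>
  define r where "r y = (\<Sum>j<n. cnj (g j) * y $ j)" for y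
  have U: "U \<in> carrier_mat (Suc n) n" and V: "V \<in> carrier_mat n (Suc n)" by (simp_all add: U_def V_def)
  have U_lt: "(U *\<^sub>v y) $ i = y $ i - g i * r y / s" if "y \<in> carrier_vec n" "i < n" for y i
  proof -
    have "(U *\<^sub>v y) $ i = (\<Sum>j<n. (if i = j then y $ j else 0) - g i / s * (cnj (g j) * y $ j))"
      using that by (subst mult_mat_vec_index) (auto simp: U_def algebra_simps intro!: sum.cong)
    thus ?thesis using that by (simp add: sum_subtractf r_def sum_distrib_left sum_divide_distrib mult_ac)
  qed
  have U_n: "(U *\<^sub>v y) $ n = r y" if "y \<in> carrier_vec n" for y
    using that by (subst mult_mat_vec_index) (auto simp: U_def r_def)
  have V_eq: "(V *\<^sub>v x) $ j = x $ j + x $ n * g j - g j * r x / s"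
    if "x \<in> carrier_vec (Suc n)" "j < n" for x j
  proof -
    have "(V *\<^sub>v x) $ j = (\<Sum>i<n. (if i = j then x $ i else 0) - g j / s * (cnj (g i) * x $ i)) + g j * x $ n"
      using that by (subst mult_mat_vec_index) (auto simp: U_def V_def algebra_simps intro!: sum.cong)
    thus ?thesis using that by (simp add: sum_subtractf r_def sum_distrib_left sum_divide_distrib mult_ac)
  qed
  have r_U: "r (U *\<^sub>v y) = r y - (1 + \<gamma>) * r y" if "y \<in> carrier_vec n" for y
  proof -
    have "r (U *\<^sub>v y) = (\<Sum>i<n. cnj (g i) * y $ i - r y / s * (cnj (g i) * g i))"
      unfolding r_def[of "U *\<^sub>v y"] using that by (intro sum.cong) (auto simp: U_lt algebra_simps)
    also have "\<dots> = r y - r y / s * (s * (1 + \<gamma>))"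
      by (simp only: sum_subtractf S r_def[of y, symmetric] flip: sum_distrib_left)
    finally show ?thesis using s0 by simp
  qed
  \<comment> \<open>Since the conjugate of \<open>g i\<close> is \<open>a * u $ i\<close>, being
    orthogonal to \<open>g\<close> is the same as pairing to zero with \<open>u\<close>.\<close>
  have r_orth: "x \<bullet> u = 0 \<longleftrightarrow> r x = - \<gamma> * x $ n" if "x \<in> carrier_vec (Suc n)" for x
  proof -
    have "a * (x \<bullet> u) = r x + \<gamma> * x $ n"
      using gn u by (simp add: scalar_prod_def r_def g_def sum_distrib_left atLeast0LessThan algebra_simps)
         (metis cnj_g(1) complex_cnj_cnj complex_cnj_mult mult.assoc mult.commute)
    thus ?thesis using a0 by (auto simp: add_eq_0_iff2)
  qed
  have "V *\<^sub>v (U *\<^sub>v y) = y" if y: "y \<in> carrier_vec n" for y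
  proof (rule eq_vecI)
    fix j assume "j < dim_vec y"
    hence j: "j < n" using y by simp
    have "U *\<^sub>v y \<in> carrier_vec (Suc n)" using U y by simp
    from V_eq[OF this j] have "(V *\<^sub>v (U *\<^sub>v y)) $ j = y $ j + g j * r y * (s - 1 + \<gamma>) / s"
      using s0 by (simp add: U_lt[OF y j] U_n[OF y] r_U[OF y] field_simps)
    thus "(V *\<^sub>v (U *\<^sub>v y)) $ j = y $ j" by (simp add: s_def)
  qed (use V y in simp)
  moreover have "(U *\<^sub>v y) \<bullet> u = 0" if y: "y \<in> carrier_vec n" for y
  proof -
    have "U *\<^sub>v y \<in> carrier_vec (Suc n)" using U y by simp
    thus ?thesis by (simp only: r_orth r_U[OF y] U_n[OF y]) (simp add: algebra_simps)
  qed
  moreover have "U *\<^sub>v (V *\<^sub>v x) = x" if x: "x \<in> carrier_vec (Suc n)" "x \<bullet> u = 0" for x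
  proof (rule eq_vecI)
    have rx: "r x = - \<gamma> * x $ n" using r_orth x by blast
    have Vx: "V *\<^sub>v x \<in> carrier_vec n" using V x by simp
    \<comment> \<open>On the hyperplane \<open>r x\<close> is determined by the last entry of
      \<open>x\<close>, and s + \<gamma> = 1 simplifies the formula for \<open>V\<close>. The
      correction added here is exactly what \<open>U\<close> subtracts, once
      \<open>r (V *\<^sub>v x)\<close> is seen to be that last entry.\<close>
    have V_lt: "(V *\<^sub>v x) $ j = x $ j + x $ n / s * g j" if "j < n" for j
    proof -
      have "(V *\<^sub>v x) $ j = x $ j + x $ n * g j * (s + \<gamma>) / s"
        using s0 by (simp add: V_eq[OF x(1) that] rx field_simps)
      thus ?thesis by (simp add: s_def)
    qed
    have "r (V *\<^sub>v x) = (\<Sum>j<n. cnj (g j) * x $ j + x $ n / s * (cnj (g j) * g j))"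
      unfolding r_def by (intro sum.cong) (auto simp: V_lt algebra_simps)
    also have "\<dots> = r x + x $ n / s * (s * (1 + \<gamma>))"
      by (simp only: sum.distrib S r_def[of x, symmetric] flip: sum_distrib_left)
    also have "\<dots> = x $ n" using s0 by (simp add: rx field_simps)
    finally have rV: "r (V *\<^sub>v x) = x $ n" .
    fix i assume "i < dim_vec x"
    hence "i < n \<or> i = n" using x by auto
    thus "(U *\<^sub>v (V *\<^sub>v x)) $ i = x $ i"
      using U_lt[OF Vx] U_n[OF Vx] V_lt rV by (auto simp: mult.commute simp del: index_mult_mat_vec)
  qed (use U x in simp)
  moreover have "(U *\<^sub>v y) \<bullet>c x = y \<bullet>c (V *\<^sub>v x)"
    if x: "x \<in> carrier_vec (Suc n)" and y: "y \<in> carrier_vec n" for x y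
  proof -
    have "(U *\<^sub>v y) \<bullet>c x = (\<Sum>i<Suc n. \<Sum>j<n. U $$ (i, j) * y $ j * cnj (x $ i))"
      using x y U by (simp add: scalar_prod_def atLeast0LessThan sum_distrib_right)
    also have "\<dots> = (\<Sum>j<n. \<Sum>i<Suc n. U $$ (i, j) * y $ j * cnj (x $ i))"
      by (rule sum.swap)
    also have "\<dots> = y \<bullet>c (V *\<^sub>v x)"
      using x y U by (simp add: scalar_prod_def atLeast0LessThan sum_distrib_left V_def algebra_simps)
    finally show ?thesis .
  qed
  ultimately show ?thesis using U V that by blast
qed

section \<open>Norm estimates, and suprema over nonempty bounded sets\<close>

lemma cscalar_prod_eq_sum:
  fixes x :: "complex vec"
  assumes "x \<in> carrier_vec n"
  shows "x \<bullet>c x = of_real (\<Sum>i<n. (cmod (x $ i))\<^sup>2)"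
  using assms by (simp add: scalar_prod_def atLeast0LessThan complex_norm_square del: of_real_power)

lemma euclidean_norm_altdef: "euclidean_norm x = sqrt (\<Sum>i<dim_vec x. (cmod (x $ i))\<^sup>2)"
  by (simp add: euclidean_norm_def cscalar_prod_eq_sum[of x "dim_vec x"])

lemma cmod_index_le_euclidean_norm:
  assumes "i < dim_vec x"
  shows "cmod (x $ i) \<le> euclidean_norm x"
  unfolding euclidean_norm_altdef
  by (rule real_le_rsqrt) (use assms in \<open>intro member_le_sum, auto\<close>)

lemma cmod_mult_mat_vec_index_le:
  assumes "euclidean_norm x \<le> 1" "dim_vec x = dim_col M" "i < dim_row M"
  shows "cmod ((M *\<^sub>v x) $ i) \<le> (\<Sum>j<dim_col M. cmod (M $$ (i, j)))"
proof -
  have "cmod ((M *\<^sub>v x) $ i) \<le> (\<Sum>j<dim_col M. cmod (M $$ (i, j) * x $ j))"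
    using assms by (subst mult_mat_vec_index) (auto intro: norm_sum)
  also have "\<dots> \<le> (\<Sum>j<dim_col M. cmod (M $$ (i, j)) * 1)"
    unfolding norm_mult using assms
    by (intro sum_mono mult_left_mono) (auto intro: order_trans[OF cmod_index_le_euclidean_norm])
  finally show ?thesis by simp
qed

text \<open>A supremum bounds its members only if the set is bounded; entries of a vector in the
  unit ball have modulus at most 1, so absolute row sums give a crude bound.\<close>

lemma euclidean_norm_le_operator_norm:
  assumes "x \<in> carrier_vec (dim_col M)" "euclidean_norm x \<le> 1"
  shows "euclidean_norm (M *\<^sub>v x) \<le> operator_norm M"
  unfolding operator_norm_def
proof (rule cSUP_upper)
  show "bdd_above ((\<lambda>x. euclidean_norm (M *\<^sub>v x)) ` {x \<in> carrier_vec (dim_col M). euclidean_norm x \<le> 1})"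
  proof (rule bdd_aboveI2)
    fix x assume "x \<in> {x \<in> carrier_vec (dim_col M). euclidean_norm x \<le> 1}"
    thus "euclidean_norm (M *\<^sub>v x) \<le> sqrt (\<Sum>i<dim_row M. (\<Sum>j<dim_col M. cmod (M $$ (i, j)))\<^sup>2)"
      unfolding euclidean_norm_altdef[of "M *\<^sub>v x"]
      by (auto intro!: sum_mono power_mono cmod_mult_mat_vec_index_le simp del: index_mult_mat_vec)
  qed
qed (use assms in auto)

lemma operator_norm_le:
  assumes "\<And>x. x \<in> carrier_vec (dim_col M) \<Longrightarrow> euclidean_norm x \<le> 1 \<Longrightarrow> euclidean_norm (M *\<^sub>v x) \<le> c"
  shows "operator_norm M \<le> c"
  unfolding operator_norm_def
proof (rule cSUP_least)
  have "0\<^sub>v (dim_col M) \<in> {x \<in> carrier_vec (dim_col M). euclidean_norm x \<le> 1}"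
    by (simp add: euclidean_norm_altdef)
  thus "{x \<in> carrier_vec (dim_col M). euclidean_norm x \<le> 1} \<noteq> {}" by blast
qed (use assms in auto)

lemma numerical_range_nonempty:
  assumes "A \<in> carrier_mat n n" "n > 0"
  shows "numerical_range A \<noteq> {}"
proof -
  have "unit_vec n 0 \<bullet>c unit_vec n 0 = (1 :: complex)"
    using assms by (simp add: scalar_prod_left_unit)
  thus ?thesis using assms unfolding numerical_range_def
    by (auto intro!: exI[of _ "unit_vec n 0"])
qed

lemma bdd_above_poly_numerical_range:
  assumes A: "A \<in> carrier_mat n n"
  shows "bdd_above ((\<lambda>z. cmod (poly p z)) ` numerical_range A)"
proof -
  \<comment> \<open>The sum of the moduli of all entries bounds the numerical range, and thereby
    every polynomial on it.\<close>
  define R where "R = (\<Sum>i<n. \<Sum>j<n. cmod (A $$ (i, j)))"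
  have bound: "cmod z \<le> R" if "z \<in> numerical_range A" for z
  proof -
    from that A obtain x where x: "x \<in> carrier_vec n" "x \<bullet>c x = 1" "z = (A *\<^sub>v x) \<bullet>c x"
      by (auto simp: numerical_range_def)
    have norm: "euclidean_norm x \<le> 1" using x by (simp add: euclidean_norm_def)
    have "cmod z \<le> (\<Sum>i<n. cmod ((A *\<^sub>v x) $ i * cnj (x $ i)))"
      using x A by (auto simp: scalar_prod_def atLeast0LessThan intro: norm_sum simp del: index_mult_mat_vec)
    also have "\<dots> \<le> (\<Sum>i<n. (\<Sum>j<n. cmod (A $$ (i, j))) * 1)"
      unfolding norm_mult complex_mod_cnj
    proof (intro sum_mono mult_mono)
      fix i assume "i \<in> {..<n}"
      thus "cmod ((A *\<^sub>v x) $ i) \<le> (\<Sum>j<n. cmod (A $$ (i, j)))" "cmod (x $ i) \<le> 1"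
        using cmod_mult_mat_vec_index_le[OF norm, of A i] cmod_index_le_euclidean_norm[of i x] norm x A
        by auto
    qed (auto intro: sum_nonneg)
    finally show ?thesis by (simp add: R_def)
  qed
  show ?thesis
  proof (rule bdd_aboveI2)
    fix z assume "z \<in> numerical_range A"
    from bound[OF this] have "cmod (coeff p k * z ^ k) \<le> cmod (coeff p k) * R ^ k" for k
      by (auto simp: norm_mult norm_power intro!: mult_left_mono power_mono)
    thus "cmod (poly p z) \<le> (\<Sum>k\<le>degree p. cmod (coeff p k) * R ^ k)"
      unfolding poly_altdef by (rule sum_norm_le)
  qed
qed

section \<open>Polynomials of matrices\<close>

lemma mat_poly_mult_vec_index:
  assumes "A \<in> carrier_mat n n" "x \<in> carrier_vec n" "i < n"
  shows "(mat_poly p A *\<^sub>v x) $ i = (\<Sum>k\<le>degree p. coeff p k * (A ^\<^sub>m k *\<^sub>v x) $ i)"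
proof -
  have "(mat_poly p A *\<^sub>v x) $ i = (\<Sum>j<n. (\<Sum>k\<le>degree p. coeff p k * (A ^\<^sub>m k) $$ (i, j)) * x $ j)"
    using assms by (subst mult_mat_vec_index) (auto simp: mat_poly_def)
  also have "\<dots> = (\<Sum>k\<le>degree p. coeff p k * (\<Sum>j<n. (A ^\<^sub>m k) $$ (i, j) * x $ j))"
    unfolding sum_distrib_left sum_distrib_right by (subst sum.swap) (simp add: mult_ac)
  also have "\<dots> = (\<Sum>k\<le>degree p. coeff p k * (A ^\<^sub>m k *\<^sub>v x) $ i)"
    using assms pow_carrier_mat[OF assms(1)] by (intro sum.cong refl, subst mult_mat_vec_index) auto
  finally show ?thesis .
qed

lemma mat_poly_carrier [simp]: "A \<in> carrier_mat n n \<Longrightarrow> mat_poly p A \<in> carrier_mat n n"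
  by (simp add: mat_poly_def)

text \<open>The relation AU = UC passes to powers by induction and to polynomials by
  linearity.\<close>

lemma mat_poly_intertwine:
  fixes A C U :: "complex mat"
  assumes A: "A \<in> carrier_mat m m" and C: "C \<in> carrier_mat n n" and U: "U \<in> carrier_mat m n"
    and AU: "\<And>y. y \<in> carrier_vec n \<Longrightarrow> A *\<^sub>v (U *\<^sub>v y) = U *\<^sub>v (C *\<^sub>v y)"
    and y: "y \<in> carrier_vec n"
  shows "mat_poly p A *\<^sub>v (U *\<^sub>v y) = U *\<^sub>v (mat_poly p C *\<^sub>v y)"
proof (rule eq_vecI)
  have pow: "A ^\<^sub>m k *\<^sub>v (U *\<^sub>v y) = U *\<^sub>v (C ^\<^sub>m k *\<^sub>v y)" for k
  proof (induction k)
    case 0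
    then show ?case using A C U y by simp
  next
    case (Suc k)
    have "U *\<^sub>v y \<in> carrier_vec m" using U y by simp
    then show ?case
      using Suc C y by (simp only: pow_mat_Suc_mult_vec[OF A] pow_mat_Suc_mult_vec[OF C y])
        (simp add: AU)
  qed
  fix i assume "i < dim_vec (U *\<^sub>v (mat_poly p C *\<^sub>v y))"
  hence i: "i < m" using U by simp
  have pC: "dim_row (mat_poly p C) = n" using C by (simp add: mat_poly_def)
  have "(mat_poly p A *\<^sub>v (U *\<^sub>v y)) $ i = (\<Sum>k\<le>degree p. coeff p k * (U *\<^sub>v (C ^\<^sub>m k *\<^sub>v y)) $ i)"
    using A U y i by (subst mat_poly_mult_vec_index[where n = m]) (auto simp: pow)
  also have "\<dots> = (\<Sum>k\<le>degree p. coeff p k * (\<Sum>j<n. U $$ (i, j) * (C ^\<^sub>m k *\<^sub>v y) $ j))"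
    using U C y i by (intro sum.cong refl, subst mult_mat_vec_index) auto
  also have "\<dots> = (\<Sum>j<n. U $$ (i, j) * (\<Sum>k\<le>degree p. coeff p k * (C ^\<^sub>m k *\<^sub>v y) $ j))"
    unfolding sum_distrib_left by (subst sum.swap) (simp add: mult_ac)
  also have "\<dots> = (\<Sum>j<n. U $$ (i, j) * (mat_poly p C *\<^sub>v y) $ j)"
    by (intro sum.cong refl, subst mat_poly_mult_vec_index[OF C y]) auto
  also have "\<dots> = (U *\<^sub>v (mat_poly p C *\<^sub>v y)) $ i"
    using U pC i by (subst mult_mat_vec_index) auto
  finally show "(mat_poly p A *\<^sub>v (U *\<^sub>v y)) $ i = (U *\<^sub>v (mat_poly p C *\<^sub>v y)) $ i" .
qed (use A U in \<open>simp add: mat_poly_def\<close>)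

section \<open>Compression to an invariant hyperplane and the induction on size\<close>

text \<open>In dimension 1 no nonzero \<open>u\<close> pairs to zero with the unit vector, so that
  vector is cyclic.\<close>

lemma cyclic_mat_1:
  assumes A: "A \<in> carrier_mat 1 1"
  shows "cyclic_mat A"
proof (rule ccontr)
  assume "\<not> cyclic_mat A"
  hence "\<not> cyclic_vector A (unit_vec 1 0)" by (auto simp: cyclic_mat_def)
  then obtain u :: "complex vec" where u: "u \<in> carrier_vec 1" "u \<noteq> 0\<^sub>v 1" "unit_vec 1 0 \<bullet> u = 0"
    using not_cyclic_vector_left_eigenvector[OF A unit_vec_carrier] by blast
  have "u $ 0 = 0" using scalar_prod_left_unit[OF u(1), of 0] u(3) by simp
  hence "u = 0\<^sub>v 1" using u(1) by (intro eq_vecI) (simp_all add: less_Suc_eq)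
  with u show False by simp
qed

text \<open>
  A vector that is not cyclic lies in an invariant hyperplane; \<open>C\<close> is the restriction of \<open>A\<close>
  to it, written in an orthonormal basis.
\<close>

lemma euclidean_norm_mat_poly_le_compression:
  fixes A :: "complex mat"
  assumes A: "A \<in> carrier_mat (Suc n) (Suc n)" and x: "x \<in> carrier_vec (Suc n)"
    and norm: "euclidean_norm x \<le> 1" and nc: "\<not> cyclic_vector A x"
  obtains C where "C \<in> carrier_mat n n" "numerical_range C \<subseteq> numerical_range A"
    "euclidean_norm (mat_poly p A *\<^sub>v x) \<le> operator_norm (mat_poly p C)"
proof -
  obtain u c where u: "u \<in> carrier_vec (Suc n)" "u \<noteq> 0\<^sub>v (Suc n)" "A\<^sup>T *\<^sub>v u = c \<cdot>\<^sub>v u" "x \<bullet> u = 0"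
    using not_cyclic_vector_left_eigenvector[OF A x nc] by blast
  obtain U V where U: "U \<in> carrier_mat (Suc n) n" and V: "V \<in> carrier_mat n (Suc n)"
    and VU: "\<And>y. y \<in> carrier_vec n \<Longrightarrow> V *\<^sub>v (U *\<^sub>v y) = y"
    and Uu: "\<And>y. y \<in> carrier_vec n \<Longrightarrow> (U *\<^sub>v y) \<bullet> u = 0"
    and UV: "\<And>x. x \<in> carrier_vec (Suc n) \<Longrightarrow> x \<bullet> u = 0 \<Longrightarrow> U *\<^sub>v (V *\<^sub>v x) = x"
    and adj: "\<And>x y. x \<in> carrier_vec (Suc n) \<Longrightarrow> y \<in> carrier_vec n \<Longrightarrow> (U *\<^sub>v y) \<bullet>c x = y \<bullet>c (V *\<^sub>v x)"
    using hyperplane_isometry[OF u(1,2)] by blast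
  define C where "C = V * (A * U)"
  have C: "C \<in> carrier_mat n n" using U V A by (simp add: C_def)
  have Uy: "U *\<^sub>v y \<in> carrier_vec (Suc n)" and AUy: "A *\<^sub>v (U *\<^sub>v y) \<in> carrier_vec (Suc n)"
    if "y \<in> carrier_vec n" for y using that U A by auto
  have C_mult: "C *\<^sub>v y = V *\<^sub>v (A *\<^sub>v (U *\<^sub>v y))" if "y \<in> carrier_vec n" for y
    using that U V A by (simp add: C_def assoc_mult_mat_vec[of _ n "Suc n" _ n]
        assoc_mult_mat_vec[of _ "Suc n" "Suc n" _ n])
  \<comment> \<open>Invariance of the hyperplane: moving \<open>A\<close> across the pairing
    multiplies by the eigenvalue \<open>c\<close> a product that is already 0, so \<open>U\<close>
    after \<open>V\<close> fixes the image.\<close>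
  have AU: "A *\<^sub>v (U *\<^sub>v y) = U *\<^sub>v (C *\<^sub>v y)" if y: "y \<in> carrier_vec n" for y
  proof -
    have "(A *\<^sub>v (U *\<^sub>v y)) \<bullet> u = (A\<^sup>T *\<^sub>v u) \<bullet> (U *\<^sub>v y)"
      using transpose_vec_mult_scalar[OF A Uy[OF y] u(1)] comm_scalar_prod[OF AUy[OF y] u(1)] by simp
    also have "\<dots> = c * ((U *\<^sub>v y) \<bullet> u)"
      using comm_scalar_prod[OF Uy[OF y] u(1)] u(1) Uy[OF y] by (simp add: u(3))
    finally have "(A *\<^sub>v (U *\<^sub>v y)) \<bullet> u = 0" using Uu[OF y] by simp
    from UV[OF AUy[OF y] this] show ?thesis by (simp add: C_mult[OF y])
  qed
  have U_isom: "(U *\<^sub>v y) \<bullet>c (U *\<^sub>v y) = y \<bullet>c y" if "y \<in> carrier_vec n" for y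
    using adj[OF Uy[OF that] that] VU[OF that] by simp
  have "numerical_range C \<subseteq> numerical_range A"
  proof
    fix z assume "z \<in> numerical_range C"
    then obtain y where y: "y \<in> carrier_vec n" "y \<bullet>c y = 1" "z = (C *\<^sub>v y) \<bullet>c y"
      using C by (auto simp: numerical_range_def)
    have Cy: "C *\<^sub>v y \<in> carrier_vec n" using C y by simp
    \<comment> \<open>By invariance \<open>A\<close> after \<open>U\<close> equals \<open>U\<close>
      after \<open>C\<close>, and \<open>V\<close> undoes \<open>U\<close> in the second
      argument.\<close>
    have "(A *\<^sub>v (U *\<^sub>v y)) \<bullet>c (U *\<^sub>v y) = z"
      using adj[OF Uy[OF y(1)] Cy] VU[OF y(1)] y by (simp add: AU)
    thus "z \<in> numerical_range A"
      using Uy[OF y(1)] U_isom[OF y(1)] y(2) A unfolding numerical_range_def by force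
  qed
  moreover have "euclidean_norm (mat_poly p A *\<^sub>v x) \<le> operator_norm (mat_poly p C)"
  proof -
    define y where "y = V *\<^sub>v x"
    have y: "y \<in> carrier_vec n" using V x by (simp add: y_def)
    have xy: "x = U *\<^sub>v y" using UV[OF x u(4)] by (simp add: y_def)
    have pC: "mat_poly p C \<in> carrier_mat n n" using C by simp
    have "mat_poly p A *\<^sub>v x = U *\<^sub>v (mat_poly p C *\<^sub>v y)"
      unfolding xy by (rule mat_poly_intertwine[OF A C U AU y])
    hence "euclidean_norm (mat_poly p A *\<^sub>v x) = euclidean_norm (mat_poly p C *\<^sub>v y)"
      using pC y by (simp add: euclidean_norm_def U_isom)
    also have "\<dots> \<le> operator_norm (mat_poly p C)"
      using norm U_isom[OF y] y pC by (intro euclidean_norm_le_operator_norm) (auto simp: xy euclidean_norm_def)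
    finally show ?thesis .
  qed
  ultimately show ?thesis using that C by blast
qed

text \<open>The compression \<open>C\<close> varies with \<open>x\<close>, so the operator norm is
  bounded one vector at a time; every bound obtained is at most the same supremum over the numerical
  range of \<open>A\<close>. With n > 0 the numerical range of \<open>C\<close> is nonempty, as
  comparing the suprema requires.\<close>

lemma crouzeix_holds_non_cyclic:
  fixes A :: "complex mat"
  assumes A: "A \<in> carrier_mat (Suc n) (Suc n)" and nc: "\<not> cyclic_mat A" and "n > 0"
    and IH: "\<And>C. C \<in> carrier_mat n n \<Longrightarrow> crouzeix_holds C"
  shows "crouzeix_holds A"
  unfolding crouzeix_holds_def
proof (intro allI operator_norm_le)
  fix p :: "complex poly" and x :: "complex vec"
  assume x: "x \<in> carrier_vec (dim_col (mat_poly p A))" "euclidean_norm x \<le> 1"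
  have "x \<in> carrier_vec (Suc n)" using x(1) A by (simp add: mat_poly_def)
  moreover have "\<not> cyclic_vector A x" using nc by (auto simp: cyclic_mat_def)
  ultimately obtain C where C: "C \<in> carrier_mat n n" "numerical_range C \<subseteq> numerical_range A"
    "euclidean_norm (mat_poly p A *\<^sub>v x) \<le> operator_norm (mat_poly p C)"
    using euclidean_norm_mat_poly_le_compression[OF A _ x(2)] by blast
  have "operator_norm (mat_poly p C) \<le> 2 * (SUP z \<in> numerical_range C. cmod (poly p z))"
    using IH[OF C(1)] by (simp add: crouzeix_holds_def)
  moreover have "(SUP z \<in> numerical_range C. cmod (poly p z)) \<le> (SUP z \<in> numerical_range A. cmod (poly p z))"
    by (rule cSUP_subset_mono[OF numerical_range_nonempty[OF C(1) \<open>n > 0\<close>]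
          bdd_above_poly_numerical_range[OF A] C(2)]) simp
  ultimately show "euclidean_norm (mat_poly p A *\<^sub>v x) \<le> 2 * (SUP z \<in> numerical_range A. cmod (poly p z))"
    using C(3) by linarith
qed

theorem corollary3p3:
  shows "(\<forall>n :: nat. n > 0 \<longrightarrow>
            (\<forall>A \<in> carrier_mat n n. crouzeix_holds A) \<longrightarrow>
            (\<forall>A \<in> carrier_mat (n + 1) (n + 1). \<not> cyclic_mat A \<longrightarrow> crouzeix_holds A))
       \<and> ((\<forall>n :: nat. n > 0 \<longrightarrow> (\<forall>A \<in> carrier_mat n n. cyclic_mat A \<longrightarrow> crouzeix_holds A)) \<longrightarrow>
          (\<forall>n :: nat. n > 0 \<longrightarrow> (\<forall>A \<in> carrier_mat n n. crouzeix_holds A)))"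
proof (intro conjI allI impI)
  show "\<forall>A \<in> carrier_mat (n + 1) (n + 1). \<not> cyclic_mat A \<longrightarrow> crouzeix_holds A"
    if "n > 0" "\<forall>A \<in> carrier_mat n n. crouzeix_holds A" for n
    using crouzeix_holds_non_cyclic[of _ n] that by auto
next
  fix n :: nat
  assume cyc: "\<forall>n :: nat. n > 0 \<longrightarrow> (\<forall>A \<in> carrier_mat n n. cyclic_mat A \<longrightarrow> crouzeix_holds A)"
    and "n > 0"
  from \<open>n > 0\<close> show "\<forall>A \<in> carrier_mat n n. crouzeix_holds A"
  proof (induction n rule: nat_induct_non_zero)
    case 1
    then show ?case using cyc cyclic_mat_1 by auto
  next
    case (Suc n)
    show ?case
    proof
      fix A :: "complex mat" assume A: "A \<in> carrier_mat (Suc n) (Suc n)"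
      show "crouzeix_holds A"
        \<comment> \<open>The cyclic case is the assumption; the other one is part (a) fed with the
          induction hypothesis.\<close>
        using cyc A crouzeix_holds_non_cyclic[OF A _ Suc.hyps] Suc.IH by (cases "cyclic_mat A") auto
    qed
  qed
qed

end
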